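(* Let $G$ be a finite simple graph and $r\ge 2$. Then there exists an AON minimum $r$-fold PSD forcing set for $G$. For every $r\ge 3$, exactly one cluster of $G^{(r)}$ is forced at each step of any forcing process that begins with any AON minimum $r$-fold PSD forcing set. For $r=2$, there exists an AON minimum $2$-fold PSD forcing set for $G$ together with a forcing process starting from it in which exactly one cluster of $G^{(2)}$ is forced at each step.
   Context: For $r\in\mathbb{N}$, the $r$-blowup $G^{(r)}$ is obtained by replacing each vertex $u$ of $G$ by an independent set $R_u$ of $r$ vertices (a cluster) and each edge $uw$ by all edges between $R_u$ and $R_w$. $r$-fold PSD forcing game: an initial set $B\subseteq V(G^{(r)})$ is blue, the rest white. A forcing process is a sequence of steps. In an ordinary step, with $B_t$ the current blue set and $W_1,\dots,W_h$ the vertex sets of the connected components of $G^{(r)}-B_t$, a vertex $u\in B_t$ with $|N(u)\cap W_i|\le r$ for some $i$ forces $N(u)\cap W_i$, i.e. colors all of these vertices blue. Forcing processes may also use backforcing steps: if a vertex of a cluster $R_u$ that is not entirely blue has just performed a force, then at the next step all vertices of $R_u$ may be colored blue. $B$ is an $r$-fold PSD forcing set if some forcing process makes all of $G^{(r)}$ blue; it is minimum if it has the minimum cardinality among such sets. A cluster is forced at a step if some of its vertices turn from white to blue at that step. Relative to a coloring of $G^{(r)}$, a cluster is an All cluster if all its vertices are blue, a One cluster if exactly one of its vertices is blue, and a None cluster if all its vertices are white. An AON $r$-fold PSD forcing set is an $r$-fold PSD forcing set $B$ such that, when $G^{(r)}$ is colored with $B$, every cluster is an All, One, or None cluster. *)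

theory Defs
  imports "Graph_Theory.Graph_Theory"
begin

text \<open>
  A finite simple graph is an AFP \<^locale>\<open>pair_graph\<close>: a finite, loop-free, symmetric digraph
  without parallel arcs, each edge being represented by its two orientations.
\<close>

definition neighborhood :: "'v pair_pre_digraph \<Rightarrow> 'v \<Rightarrow> 'v set" where
  "neighborhood H v = {w. (v, w) \<in> parcs H}"

definition cluster :: "nat \<Rightarrow> 'a \<Rightarrow> ('a \<times> nat) set" where
  "cluster r u = {u} \<times> {..<r}"

definition blowup :: "nat \<Rightarrow> 'a pair_pre_digraph \<Rightarrow> ('a \<times> nat) pair_pre_digraph" where
  "blowup r G =
    \<lparr> pverts = (\<Union>u\<in>pverts G. cluster r u),
      parcs = (\<Union>(u, w)\<in>parcs G. cluster r u \<times> cluster r w) \<rparr>"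

text \<open>
  The vertex sets of the connected components of \<open>H - B\<close>. For a symmetric digraph, the strongly
  connected components are exactly the connected components of the underlying graph.
\<close>
definition white_components :: "'v pair_pre_digraph \<Rightarrow> 'v set \<Rightarrow> 'v set set" where
  "white_components H B = pre_digraph.sccs_verts (with_proj H \<restriction> (pverts H - B))"

text \<open>
  \<open>Force v W\<close> is the step in which \<open>v\<close> forces its neighbors in the white component \<open>W\<close>;
  \<open>Backforce u\<close> is the step in which the whole cluster of \<open>u\<close> is colored blue.
\<close>
datatype 'a forcing_step = Force "'a \<times> nat" "('a \<times> nat) set" | Backforce 'a

fun colored_by :: "'a pair_pre_digraph \<Rightarrow> nat \<Rightarrow> 'a forcing_step \<Rightarrow> ('a \<times> nat) set" where
  "colored_by G r (Force v W) = neighborhood (blowup r G) v \<inter> W"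
| "colored_by G r (Backforce u) = cluster r u"

text \<open>The blue set \<open>B\<^sub>t\<close> before step \<open>t\<close> (steps are numbered from \<open>0\<close>).\<close>
definition blue_at ::
  "'a pair_pre_digraph \<Rightarrow> nat \<Rightarrow> ('a \<times> nat) set \<Rightarrow> 'a forcing_step list \<Rightarrow> nat \<Rightarrow> ('a \<times> nat) set"
where
  "blue_at G r B ss t = B \<union> (\<Union>s\<in>set (take t ss). colored_by G r s)"

text \<open>
  A force must color at least one vertex: without this requirement, a vertex could ``force'' the
  empty set and thereby license a backforcing step for free.
  A process may stop at any time; in particular it need not turn the whole graph blue.
\<close>
definition forcing_process ::
  "'a pair_pre_digraph \<Rightarrow> nat \<Rightarrow> ('a \<times> nat) set \<Rightarrow> 'a forcing_step list \<Rightarrow> bool"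
where
  "forcing_process G r B ss \<longleftrightarrow>
    B \<subseteq> pverts (blowup r G) \<and>
    (\<forall>t<length ss. case ss ! t of
        Force v W \<Rightarrow>
          v \<in> blue_at G r B ss t \<and>
          W \<in> white_components (blowup r G) (blue_at G r B ss t) \<and>
          neighborhood (blowup r G) v \<inter> W \<noteq> {} \<and>
          card (neighborhood (blowup r G) v \<inter> W) \<le> r
      | Backforce u \<Rightarrow>
          0 < t \<and> (\<exists>i W. ss ! (t - 1) = Force (u, i) W) \<and>
          \<not> cluster r u \<subseteq> blue_at G r B ss t)"

definition complete_forcing_process ::
  "'a pair_pre_digraph \<Rightarrow> nat \<Rightarrow> ('a \<times> nat) set \<Rightarrow> 'a forcing_step list \<Rightarrow> bool"
where
  "complete_forcing_process G r B ss \<longleftrightarrow>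
    forcing_process G r B ss \<and> blue_at G r B ss (length ss) = pverts (blowup r G)"

definition psd_forcing_set :: "'a pair_pre_digraph \<Rightarrow> nat \<Rightarrow> ('a \<times> nat) set \<Rightarrow> bool" where
  "psd_forcing_set G r B \<longleftrightarrow> (\<exists>ss. complete_forcing_process G r B ss)"

definition minimum_psd_forcing_set :: "'a pair_pre_digraph \<Rightarrow> nat \<Rightarrow> ('a \<times> nat) set \<Rightarrow> bool" where
  "minimum_psd_forcing_set G r B \<longleftrightarrow> is_arg_min card (psd_forcing_set G r) B"

definition all_cluster :: "('a \<times> nat) set \<Rightarrow> ('a \<times> nat) set \<Rightarrow> bool" where
  "all_cluster B R \<longleftrightarrow> R \<subseteq> B"

definition one_cluster :: "('a \<times> nat) set \<Rightarrow> ('a \<times> nat) set \<Rightarrow> bool" where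
  "one_cluster B R \<longleftrightarrow> card (R \<inter> B) = 1"

definition none_cluster :: "('a \<times> nat) set \<Rightarrow> ('a \<times> nat) set \<Rightarrow> bool" where
  "none_cluster B R \<longleftrightarrow> R \<inter> B = {}"

definition aon_psd_forcing_set :: "'a pair_pre_digraph \<Rightarrow> nat \<Rightarrow> ('a \<times> nat) set \<Rightarrow> bool" where
  "aon_psd_forcing_set G r B \<longleftrightarrow>
    psd_forcing_set G r B \<and>
    (\<forall>R\<in>cluster r ` pverts G. all_cluster B R \<or> one_cluster B R \<or> none_cluster B R)"

definition aon_minimum_psd_forcing_set ::
  "'a pair_pre_digraph \<Rightarrow> nat \<Rightarrow> ('a \<times> nat) set \<Rightarrow> bool" where
  "aon_minimum_psd_forcing_set G r B \<longleftrightarrow>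
    aon_psd_forcing_set G r B \<and> minimum_psd_forcing_set G r B"

definition forced_at ::
  "'a pair_pre_digraph \<Rightarrow> nat \<Rightarrow> ('a \<times> nat) set \<Rightarrow> 'a forcing_step list \<Rightarrow> nat \<Rightarrow> ('a \<times> nat) set \<Rightarrow> bool"
where
  "forced_at G r B ss t R \<longleftrightarrow> R \<inter> (blue_at G r B ss (Suc t) - blue_at G r B ss t) \<noteq> {}"

definition one_cluster_forced_each_step ::
  "'a pair_pre_digraph \<Rightarrow> nat \<Rightarrow> ('a \<times> nat) set \<Rightarrow> 'a forcing_step list \<Rightarrow> bool"
where
  "one_cluster_forced_each_step G r B ss \<longleftrightarrow>
    (\<forall>t<length ss. \<exists>!R. R \<in> cluster r ` pverts G \<and> forced_at G r B ss t R)"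

end

(*
  Run a forcing process of a minimum set B backwards. Suppose u forces its neighbors in a white
  component, whose white vertices meet the clusters of w_1, ..., w_k. At most r vertices are forced,
  so these k clusters contain at least (k - 1) r blue vertices. Hence it costs nothing to make w_1
  a None cluster and w_2, ..., w_k All clusters, and then u forces the cluster of w_1 alone. If the
  cluster of u is not entirely blue, its unique blue vertex suffices for this force, and a
  backforcing step completes it. A cluster all of whose neighboring clusters are blue needs no blue
  vertex, because its vertices are singleton components.
*)

theory Submission
  imports Defs
begin

text \<open>The exchange relies on a force taking every white vertex of each cluster that it meets.
  This fails once all neighboring clusters of a cluster are blue: its white vertices can then be
  forced one at a time, and such a force pays for nothing. The induction claim therefore compares
  blue vertices over the active clusters only, and the exchanged set treats all other clusters as
  entirely blue. Going backwards, a cluster enters the comparison at the force that deactivated it,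
  in one of three ways: it was forced, it performed the force, or it lost its last neighbor with
  white vertices. Clusters of the third kind receive no blue vertex. Clusters that are inactive in
  the initial set never enter the comparison and are whitened at the very end. The resulting process
  forces one cluster per step for every r \<ge> 2. For arbitrary processes r = 2 is exceptional: two
  One clusters then have 2 (r - 1) = r white vertices together, few enough for a single
  force.\<close>

section \<open>White components as reachability classes\<close>

lemma rtrancl_on_sym_iff:
  assumes "sym A"
  shows "(x, y) \<in> rtrancl_on S A \<longleftrightarrow> (y, x) \<in> rtrancl_on S A"
  using rtrancl_on_sym[OF assms] by (auto dest: symD)

text \<open>A walk that stays in a vertex set uses only arcs of the induced subgraph. Reachability
  can thus be handled with one fixed arc set while the blue set varies.\<close>

lemma white_components_reachable:
  "(x \<rightarrow>\<^sup>*\<^bsub>with_proj H \<restriction> (pverts H - X)\<^esub> y) \<longleftrightarrow> (x, y) \<in> rtrancl_on (pverts H - X) (parcs H)"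
  (is "?L \<longleftrightarrow> ?R")
proof -
  let ?S = "pverts H - X"
  have ends: "arcs_ends (with_proj H \<restriction> ?S) = {(a, b) \<in> parcs H. a \<in> ?S \<and> b \<in> ?S}"
    by (auto simp: arcs_ends_def arc_to_ends_def induce_subgraph_def)
  have "?R" if "?L"
    using that unfolding reachable_def ends
    by (induct rule: rtrancl_on_induct) (auto intro: rtrancl_on_into_rtrancl_on)
  moreover have "?L" if "?R"
    using that unfolding reachable_def ends
    by (induct rule: rtrancl_on_induct) (auto intro: rtrancl_on_into_rtrancl_on)
  ultimately show ?thesis by blast
qed

lemma white_components_iff:
  assumes "sym (parcs H)"
  shows "W \<in> white_components H X \<longleftrightarrow>
    (\<exists>x\<in>pverts H - X. W = {y. (x, y) \<in> rtrancl_on (pverts H - X) (parcs H)})"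
proof -
  let ?R = "rtrancl_on (pverts H - X) (parcs H)"
  have s: "(y, x) \<in> ?R" if "(x, y) \<in> ?R" for x y
    using that rtrancl_on_sym_iff[OF assms] by blast
  have mem: "W \<in> white_components H X \<longleftrightarrow> W \<noteq> {} \<and> (\<forall>u\<in>W. \<forall>v\<in>W. (u, v) \<in> ?R) \<and>
      (\<forall>u\<in>W. \<forall>v. v \<notin> W \<longrightarrow> (u, v) \<notin> ?R \<or> (v, u) \<notin> ?R)"
    by (simp add: white_components_def pre_digraph.sccs_verts_def white_components_reachable)
  show ?thesis
  proof
    assume W: "W \<in> white_components H X"
    then obtain x where x: "x \<in> W" using mem by blast
    have "(x, x) \<in> ?R" using W x unfolding mem by metis
    then have "x \<in> pverts H - X" by (rule in_rtrancl_on_in_F)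
    moreover have "W = {y. (x, y) \<in> ?R}" using W x s unfolding mem by blast
    ultimately show "\<exists>x\<in>pverts H - X. W = {y. (x, y) \<in> ?R}" by blast
  next
    assume "\<exists>x\<in>pverts H - X. W = {y. (x, y) \<in> ?R}"
    then obtain x where x: "x \<in> pverts H - X" "W = {y. (x, y) \<in> ?R}" by blast
    then have "x \<in> W" by simp
    then show "W \<in> white_components H X"
      unfolding mem using x(2) s by (auto intro: rtrancl_on_trans)
  qed
qed

section \<open>Vertices and edges of the blowup\<close>

locale psd_game =
  fixes G :: "'a pair_pre_digraph" and r :: nat
  assumes graph: "pair_graph G" and r2: "2 \<le> r"
begin

lemma finite_verts: "finite (pverts G)"
  using graph by (simp add: pair_graph_def pair_digraph_def pair_fin_digraph_def pair_fin_digraph_axioms_def)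

lemma edge_sym: "(u, v) \<in> parcs G \<Longrightarrow> (v, u) \<in> parcs G"
  using graph by (auto simp: pair_graph_def pair_pseudo_graph_def pair_sym_digraph_def
      pair_sym_digraph_axioms_def symmetric_def dest: symD)

lemma edge_verts: "(u, v) \<in> parcs G \<Longrightarrow> u \<in> pverts G" "(u, v) \<in> parcs G \<Longrightarrow> v \<in> pverts G"
proof -
  interpret pair_graph G by (rule graph)
  show "(u, v) \<in> parcs G \<Longrightarrow> u \<in> pverts G" "(u, v) \<in> parcs G \<Longrightarrow> v \<in> pverts G"
    by (auto dest: in_arcsD1 in_arcsD2)
qed

lemma no_loop: "(u, u) \<notin> parcs G"
proof -
  interpret pair_graph G by (rule graph)
  show ?thesis using pair_no_loops by fastforce
qed

abbreviation verts_r :: "('a \<times> nat) set" where "verts_r \<equiv> pverts (blowup r G)"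
abbreviation nbrs :: "'a \<times> nat \<Rightarrow> ('a \<times> nat) set" where "nbrs \<equiv> neighborhood (blowup r G)"

lemma in_cluster [simp]: "(v, i) \<in> cluster r u \<longleftrightarrow> v = u \<and> i < r"
  by (auto simp: cluster_def)

lemma card_cluster [simp]: "card (cluster r u) = r" and finite_cluster [simp]: "finite (cluster r u)"
  by (auto simp: cluster_def card_cartesian_product)

lemma in_verts_r [simp]: "(v, i) \<in> verts_r \<longleftrightarrow> v \<in> pverts G \<and> i < r"
  by (auto simp: blowup_def)

lemma in_nbrs [simp]: "(w, j) \<in> nbrs (v, i) \<longleftrightarrow> (v, w) \<in> parcs G \<and> i < r \<and> j < r"
  by (force simp: neighborhood_def blowup_def)

lemma finite_verts_r: "finite verts_r"
  by (simp add: blowup_def finite_verts)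

lemma parcs_blowup: "((v, i), (w, j)) \<in> parcs (blowup r G) \<longleftrightarrow> (v, w) \<in> parcs G \<and> i < r \<and> j < r"
  by (force simp: blowup_def)

lemma sym_blowup: "sym (parcs (blowup r G))"
proof (rule symI)
  fix x y :: "'a \<times> nat" assume "(x, y) \<in> parcs (blowup r G)"
  then show "(y, x) \<in> parcs (blowup r G)"
    by (cases x, cases y) (simp add: parcs_blowup edge_sym)
qed

section \<open>Unfilled and active clusters\<close>

definition unfilled :: "('a \<times> nat) set \<Rightarrow> 'a set" where
  "unfilled X = {v \<in> pverts G. \<not> cluster r v \<subseteq> X}"

text \<open>
  The white vertices of a partially blue cluster that is not active are singleton components.
\<close>
definition active :: "('a \<times> nat) set \<Rightarrow> 'a set" where
  "active X = {v \<in> unfilled X. \<exists>w\<in>unfilled X. (v, w) \<in> parcs G}"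

lemma unfilled_iff: "v \<in> unfilled X \<longleftrightarrow> v \<in> pverts G \<and> (\<exists>i<r. (v, i) \<notin> X)"
  by (auto simp: unfilled_def subset_iff)

lemma unfilled_mono: "X \<subseteq> Y \<Longrightarrow> unfilled Y \<subseteq> unfilled X"
  by (auto simp: unfilled_def)

lemma active_mono: "X \<subseteq> Y \<Longrightarrow> active Y \<subseteq> active X"
  using unfilled_mono[of X Y] by (auto simp: active_def)

lemma activeI: "v \<in> unfilled X \<Longrightarrow> w \<in> unfilled X \<Longrightarrow> (v, w) \<in> parcs G \<Longrightarrow> v \<in> active X"
  by (auto simp: active_def)

lemma active_unfilled: "v \<in> active X \<Longrightarrow> v \<in> unfilled X"
  by (simp add: active_def)

lemma active_verts: "v \<in> active X \<Longrightarrow> v \<in> pverts G"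
  by (auto simp: active_def unfilled_def)

lemma finite_active [simp]: "finite (active X)"
  by (rule finite_subset[OF _ finite_verts]) (auto dest: active_verts)

section \<open>White components of the blowup, seen in \<open>G\<close>\<close>

lemma component_white:
  assumes "W \<in> white_components (blowup r G) X"
  shows "W \<subseteq> verts_r - X"
proof
  fix y assume y: "y \<in> W"
  obtain x where "W = {y. (x, y) \<in> rtrancl_on (verts_r - X) (parcs (blowup r G))}"
    using assms unfolding white_components_iff[OF sym_blowup] by metis
  then have "(x, y) \<in> rtrancl_on (verts_r - X) (parcs (blowup r G))" using y by simp
  then show "y \<in> verts_r - X" by (rule in_rtrancl_on_in_F)
qed

lemma component_exists:
  assumes "x \<in> verts_r - X"
  obtains W where "W \<in> white_components (blowup r G) X" "x \<in> W"
proof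
  let ?W = "{y. (x, y) \<in> rtrancl_on (verts_r - X) (parcs (blowup r G))}"
  show "?W \<in> white_components (blowup r G) X"
    unfolding white_components_iff[OF sym_blowup] by (rule bexI[OF _ assms]) (rule refl)
  show "x \<in> ?W" using assms by simp
qed

lemma component_eq:
  assumes "W \<in> white_components (blowup r G) X" "x \<in> W"
  shows "W = {y. (x, y) \<in> rtrancl_on (verts_r - X) (parcs (blowup r G))}"
proof -
  let ?R = "rtrancl_on (verts_r - X) (parcs (blowup r G))"
  obtain x0 where W: "W = {y. (x0, y) \<in> ?R}"
    using assms(1) unfolding white_components_iff[OF sym_blowup] by metis
  then have x: "(x0, x) \<in> ?R" "(x, x0) \<in> ?R"
    using assms(2) rtrancl_on_sym_iff[OF sym_blowup] by simp_all
  have "(x0, y) \<in> ?R \<longleftrightarrow> (x, y) \<in> ?R" for y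
    using rtrancl_on_trans[OF x(1), of y] rtrancl_on_trans[OF x(2), of y] by argo
  then show ?thesis unfolding W by simp
qed

text \<open>An edge leaving a white vertex over \<open>w\<close> towards a white vertex over
  \<open>v\<close> would make both clusters unfilled and adjacent, hence \<open>w\<close>
  active.\<close>

lemma component_inactive:
  assumes "W \<in> white_components (blowup r G) X" "(w, j) \<in> W" "w \<notin> active X"
  shows "W = {(w, j)}"
proof -
  have wj: "(w, j) \<in> verts_r - X" using component_white assms by blast
  have "y = (w, j)" if "((w, j), y) \<in> rtrancl_on (verts_r - X) (parcs (blowup r G))" for y
    using that
  proof (induct rule: rtrancl_on_induct)
    case (step y z)
    obtain v k where z: "z = (v, k)" by force
    have "w \<in> unfilled X" "v \<in> unfilled X" "(w, v) \<in> parcs G"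
      using wj step z by (auto simp: unfilled_iff parcs_blowup)
    then show ?case using assms(3) activeI by blast
  qed simp
  moreover have "((w, j), (w, j)) \<in> rtrancl_on (verts_r - X) (parcs (blowup r G))"
    using wj by simp
  ultimately show ?thesis unfolding component_eq[OF assms(1,2)] by auto
qed

text \<open>Walks of white vertices project to walks of unfilled clusters, and they lift back
  because white vertices over adjacent vertices of \<open>G\<close> are adjacent. Activity is needed
  for two white vertices of one cluster: they are not adjacent, and a white vertex of a neighboring
  cluster joins them.\<close>

lemma component_active:
  assumes "W \<in> white_components (blowup r G) X" "(w, j) \<in> W" "w \<in> active X"
  shows "(v, k) \<in> W \<longleftrightarrow> (v, k) \<in> verts_r - X \<and> (w, v) \<in> rtrancl_on (unfilled X) (parcs G)"
proof -
  let ?R = "rtrancl_on (verts_r - X) (parcs (blowup r G))"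
  have wj: "(w, j) \<in> verts_r - X" using component_white assms by blast
  have proj: "(w, fst y) \<in> rtrancl_on (unfilled X) (parcs G)" if "((w, j), y) \<in> ?R" for y
    using that
  proof (induct rule: rtrancl_on_induct)
    case base
    then show ?case by (auto simp: unfilled_iff)
  next
    case (step y z)
    then have "(fst y, fst z) \<in> parcs G \<and> fst z \<in> unfilled X"
      by (cases y; cases z) (auto simp: parcs_blowup unfilled_iff)
    with step show ?case by (blast intro: rtrancl_on_into_rtrancl_on)
  qed
  have refl_w: "((w, j), (w, k)) \<in> ?R" if k: "(w, k) \<in> verts_r - X" for k
  proof -
    obtain w' i where w': "(w, w') \<in> parcs G" "i < r" "(w', i) \<in> verts_r - X"
      using assms(3) by (auto simp: active_def unfilled_iff)
    have "((w, j), (w', i)) \<in> ?R"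
      using wj w' by (intro rtrancl_on_into_rtrancl_on[OF rtrancl_on_refl]) (auto simp: parcs_blowup)
    then show ?thesis
      by (rule rtrancl_on_into_rtrancl_on) (use w' k edge_sym[of w w'] in \<open>auto simp: parcs_blowup\<close>)
  qed
  have lift: "\<forall>k. (v, k) \<in> verts_r - X \<longrightarrow> ((w, j), (v, k)) \<in> ?R"
    if "(w, v) \<in> rtrancl_on (unfilled X) (parcs G)"
    using that
  proof (induct rule: rtrancl_on_induct)
    case base
    then show ?case using refl_w by blast
  next
    case (step y z)
    then obtain i where i: "(y, i) \<in> verts_r - X" by (auto simp: unfilled_iff)
    show ?case
    proof (intro allI impI)
      fix k assume k: "(z, k) \<in> verts_r - X"
      have "((w, j), (y, i)) \<in> ?R" using step i by blast
      then show "((w, j), (z, k)) \<in> ?R"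
        by (rule rtrancl_on_into_rtrancl_on) (use step i k in \<open>auto simp: parcs_blowup\<close>)
    qed
  qed
  have "(v, k) \<in> W \<longleftrightarrow> ((w, j), (v, k)) \<in> ?R"
    using component_eq[OF assms(1,2)] by blast
  then show ?thesis using proj lift in_rtrancl_on_in_F by fastforce
qed

section \<open>The effect of a single force\<close>

definition valid_force :: "('a \<times> nat) set \<Rightarrow> 'a \<times> nat \<Rightarrow> ('a \<times> nat) set \<Rightarrow> bool" where
  "valid_force X v W \<longleftrightarrow> v \<in> X \<and> W \<in> white_components (blowup r G) X \<and>
    nbrs v \<inter> W \<noteq> {} \<and> card (nbrs v \<inter> W) \<le> r"

lemma valid_force_white: "valid_force X v W \<Longrightarrow> W \<subseteq> verts_r - X"
  by (simp add: valid_force_def component_white)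

lemma valid_forceE:
  assumes "valid_force X (u, i) W"
  obtains w j where "(w, j) \<in> nbrs (u, i) \<inter> W" "(u, w) \<in> parcs G" "i < r" "w \<in> unfilled X"
proof -
  obtain p where p: "p \<in> nbrs (u, i) \<inter> W" using assms unfolding valid_force_def by blast
  obtain w j where wj: "p = (w, j)" by force
  have "w \<in> unfilled X" using p wj valid_force_white[OF assms] by (auto simp: unfilled_iff)
  then show thesis using that p wj by auto
qed

text \<open>The white vertices of an active cluster lie in one component and have the same
  neighbors, so a force that takes one of them takes them all.\<close>

lemma force_fills_active:
  assumes "valid_force X (u, i) W" "(v, k) \<in> nbrs (u, i) \<inter> W" "v \<in> active X"
  shows "cluster r v \<subseteq> X \<union> (nbrs (u, i) \<inter> W)"
proof -
  have W: "W \<in> white_components (blowup r G) X" using assms by (simp add: valid_force_def)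
  have v: "(v, v) \<in> rtrancl_on (unfilled X) (parcs G)" using assms(3) by (auto simp: active_def)
  show ?thesis
    using assms component_active[OF W _ assms(3)] v by (auto dest: active_verts)
qed

text \<open>A force that touches an active cluster fills it, so a cluster that is still active
  afterwards was not touched and its blue count is unchanged.\<close>

lemma force_active:
  assumes "valid_force X (u, i) W" "v \<in> active (X \<union> (nbrs (u, i) \<inter> W))"
  shows "v \<in> active X" "cluster r v \<inter> (X \<union> (nbrs (u, i) \<inter> W)) = cluster r v \<inter> X"
proof -
  let ?X' = "X \<union> (nbrs (u, i) \<inter> W)"
  show v: "v \<in> active X" using assms(2) active_mono[of X ?X'] by blast
  have "\<not> cluster r v \<subseteq> ?X'" using assms(2) by (auto simp: active_def unfilled_def)
  then have "(v, k) \<notin> nbrs (u, i) \<inter> W" for k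
    using force_fills_active[OF assms(1) _ v] by blast
  then show "cluster r v \<inter> ?X' = cluster r v \<inter> X" by auto
qed

text \<open>
  After a force by a vertex of a cluster that is not entirely blue, all neighbouring clusters are
  blue. Hence a backforcing step saves nothing over forcing the vertices of that cluster one by one.
\<close>
lemma force_inactivates:
  assumes "valid_force X (u, i) W"
  shows "u \<notin> active (X \<union> (nbrs (u, i) \<inter> W))"
proof
  let ?X' = "X \<union> (nbrs (u, i) \<inter> W)"
  assume u: "u \<in> active ?X'"
  then obtain u' where u': "u' \<in> unfilled ?X'" "(u, u') \<in> parcs G" by (auto simp: active_def)
  then have uX: "u \<in> unfilled X" "u' \<in> unfilled X"
    using u unfilled_mono[of X ?X'] by (auto simp: active_def)
  obtain w j where w: "(w, j) \<in> nbrs (u, i) \<inter> W" "(u, w) \<in> parcs G" and wX: "w \<in> unfilled X"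
    using valid_forceE[OF assms] .
  have W: "W \<in> white_components (blowup r G) X" using assms by (simp add: valid_force_def)
  have wu: "(w, u) \<in> parcs G" using w edge_sym[of u w] by simp
  have wa: "w \<in> active X" using activeI wX uX(1) wu .
  \<comment> \<open>The white vertices over \<open>u\<close> join \<open>w\<close> to the neighbor
    \<open>u'\<close>. Hence \<open>W\<close> contains every white vertex over \<open>u'\<close>,
    and the force fills that cluster as well.\<close>
  have "(w, u) \<in> rtrancl_on (unfilled X) (parcs G)"
    using rtrancl_on_into_rtrancl_on[OF rtrancl_on_refl] wX wu uX(1) .
  then have "(w, u') \<in> rtrancl_on (unfilled X) (parcs G)"
    by (rule rtrancl_on_into_rtrancl_on) (use u' uX in auto)
  then have "(u', k) \<in> W" if "k < r" "(u', k) \<notin> X" for k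
    using that component_active[OF W _ wa, of j u' k] w(1) uX(2) by (simp add: unfilled_iff)
  then have "cluster r u' \<subseteq> ?X'"
    using w u'(2) by auto
  then show False using u' by (auto simp: unfilled_def)
qed

section \<open>Steps of a forcing process\<close>

lemma blue_at_Cons [simp]:
  "blue_at G r X (s # ss) 0 = X"
  "blue_at G r X (s # ss) (Suc t) = blue_at G r (X \<union> colored_by G r s) ss t"
  by (auto simp: blue_at_def)

lemma blue_at_0: "blue_at G r X ss 0 = X"
  by (simp add: blue_at_def)

lemma blue_at_Suc:
  "t < length ss \<Longrightarrow> blue_at G r X ss (Suc t) = blue_at G r X ss t \<union> colored_by G r (ss ! t)"
  by (auto simp: blue_at_def take_Suc_conv_app_nth)

lemma forcing_process_iff:
  "forcing_process G r B ss \<longleftrightarrow> B \<subseteq> verts_r \<and> (\<forall>t<length ss. case ss ! t of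
      Force v W \<Rightarrow> valid_force (blue_at G r B ss t) v W
    | Backforce u \<Rightarrow> 0 < t \<and> (\<exists>i W. ss ! (t - 1) = Force (u, i) W) \<and>
        \<not> cluster r u \<subseteq> blue_at G r B ss t)"
  by (simp only: forcing_process_def valid_force_def)

text \<open>By \<open>force_inactivates\<close>, the force that licenses a backforcing step leaves
  its own cluster inactive. Recording this here spares later arguments from looking back at the
  preceding step.\<close>

lemma process_cases:
  assumes "forcing_process G r B ss" "t < length ss"
  obtains (Force) u i W where "ss ! t = Force (u, i) W" "valid_force (blue_at G r B ss t) (u, i) W"
  | (Backforce) u where "ss ! t = Backforce u" "u \<in> unfilled (blue_at G r B ss t)"
      "u \<notin> active (blue_at G r B ss t)" "\<exists>w. (w, u) \<in> parcs G"
proof -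
  have step: "case ss ! t of
      Force v W \<Rightarrow> valid_force (blue_at G r B ss t) v W
    | Backforce u \<Rightarrow> 0 < t \<and> (\<exists>i W. ss ! (t - 1) = Force (u, i) W) \<and>
        \<not> cluster r u \<subseteq> blue_at G r B ss t" if "t < length ss" for t
    using assms(1) that unfolding forcing_process_iff by blast
  show thesis
  proof (cases "ss ! t")
    case (Force v W)
    then show ?thesis
      using step[OF assms(2)] Force that(1)[of "fst v" "snd v" W] by simp
  next
    case (Backforce u)
    then obtain i W t' where t: "t = Suc t'" "ss ! t' = Force (u, i) W"
        "\<not> cluster r u \<subseteq> blue_at G r B ss t"
      using step[OF assms(2)] by (cases t) auto
    have f: "valid_force (blue_at G r B ss t') (u, i) W"
      using step[of t'] t assms(2) by simp
    have eq: "blue_at G r B ss t = blue_at G r B ss t' \<union> (nbrs (u, i) \<inter> W)"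
      using blue_at_Suc[of t' ss B] t assms(2) by simp
    obtain w where w: "(w, u) \<in> parcs G" using valid_forceE[OF f] edge_sym by metis
    then have "u \<in> pverts G" by (rule edge_verts)
    then have "u \<in> unfilled (blue_at G r B ss t)" using t by (simp add: unfilled_def)
    then show ?thesis using that(2) Backforce force_inactivates[OF f] eq w by auto
  qed
qed

section \<open>Building processes that force one cluster per step\<close>

definition one_forced :: "('a \<times> nat) set \<Rightarrow> ('a \<times> nat) set \<Rightarrow> bool" where
  "one_forced X Y \<longleftrightarrow> (\<exists>!R. R \<in> cluster r ` pverts G \<and> R \<inter> (Y - X) \<noteq> {})"

lemma one_forcedI:
  assumes "w \<in> pverts G" "Y - X \<subseteq> cluster r w" "Y - X \<noteq> {}"
  shows "one_forced X Y"
  unfolding one_forced_def using assms by (intro ex1I[of _ "cluster r w"]) fastforce+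

lemma one_cluster_forced_iff:
  "one_cluster_forced_each_step G r X ss \<longleftrightarrow>
    (\<forall>t<length ss. one_forced (blue_at G r X ss t) (blue_at G r X ss (Suc t)))"
  by (simp add: one_cluster_forced_each_step_def forced_at_def one_forced_def)

definition good :: "('a \<times> nat) set \<Rightarrow> bool" where
  "good X \<longleftrightarrow> (\<exists>ss. complete_forcing_process G r X ss \<and> one_cluster_forced_each_step G r X ss)"

lemma good_subset: "good X \<Longrightarrow> X \<subseteq> verts_r"
  by (auto simp: good_def complete_forcing_process_def forcing_process_def)

lemma good_verts: "good verts_r"
  unfolding good_def
  by (rule exI[of _ "[]"]) (simp add: complete_forcing_process_def forcing_process_def blue_at_def
      one_cluster_forced_each_step_def)

lemma good_force:
  assumes f: "valid_force X v W" "w \<in> pverts G" "nbrs v \<inter> W \<subseteq> cluster r w"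
    and good: "good (X \<union> (nbrs v \<inter> W))"
  shows "good X"
proof -
  let ?X' = "X \<union> (nbrs v \<inter> W)"
  obtain ss where ss: "complete_forcing_process G r ?X' ss" "one_cluster_forced_each_step G r ?X' ss"
    using good by (auto simp: good_def)
  let ?s = "Force v W"
  have sub: "X \<subseteq> verts_r" using good_subset[OF good] by blast
  have one: "one_forced X ?X'"
    using f valid_force_white[OF f(1)] by (intro one_forcedI[of w]) (auto simp: valid_force_def)
  have "forcing_process G r X (?s # ss)"
    unfolding forcing_process_iff
  proof (intro conjI allI impI sub)
    fix t assume "t < length (?s # ss)"
    then show "case (?s # ss) ! t of
        Force v W \<Rightarrow> valid_force (blue_at G r X (?s # ss) t) v W
      | Backforce u \<Rightarrow>
          0 < t \<and> (\<exists>i W. (?s # ss) ! (t - 1) = Force (u, i) W) \<and>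
          \<not> cluster r u \<subseteq> blue_at G r X (?s # ss) t"
    proof (cases t)
      case 0
      then show ?thesis using f by simp
    next
      case (Suc t')
      then have "t' < length ss" using \<open>t < length (?s # ss)\<close> by simp
      then show ?thesis using ss(1) Suc
        unfolding complete_forcing_process_def forcing_process_iff
        by (auto split: forcing_step.splits)
    qed
  qed
  moreover have "one_cluster_forced_each_step G r X (?s # ss)"
    unfolding one_cluster_forced_iff
  proof (intro allI impI)
    fix t assume "t < length (?s # ss)"
    then show "one_forced (blue_at G r X (?s # ss) t) (blue_at G r X (?s # ss) (Suc t))"
      using one ss(2) unfolding one_cluster_forced_iff by (cases t) (auto simp: blue_at_0)
  qed
  ultimately show ?thesis
    using ss(1) unfolding good_def complete_forcing_process_def by (intro exI[of _ "?s # ss"]) simp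
qed

text \<open>The two steps are prefixed together because a process cannot begin with backforcing, so
  the state between them cannot be treated by a separate prefixing lemma.\<close>

lemma good_force_backforce:
  assumes f: "valid_force X (u, i) W" "w \<in> pverts G" "nbrs (u, i) \<inter> W \<subseteq> cluster r w"
    and u: "u \<in> pverts G" "\<not> cluster r u \<subseteq> X \<union> (nbrs (u, i) \<inter> W)"
    and good: "good (X \<union> (nbrs (u, i) \<inter> W) \<union> cluster r u)"
  shows "good X"
proof -
  let ?X1 = "X \<union> (nbrs (u, i) \<inter> W)"
  let ?X2 = "?X1 \<union> cluster r u"
  obtain ss where ss: "complete_forcing_process G r ?X2 ss" "one_cluster_forced_each_step G r ?X2 ss"
    using good by (auto simp: good_def)
  let ?s = "Force (u, i) W" and ?s' = "Backforce u"
  have sub: "X \<subseteq> verts_r" using good_subset[OF good] by blast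
  have one: "one_forced X ?X1"
    using f valid_force_white[OF f(1)] by (intro one_forcedI[of w]) (auto simp: valid_force_def)
  have one': "one_forced ?X1 ?X2"
    using u by (intro one_forcedI[of u]) auto
  have "forcing_process G r X (?s # ?s' # ss)"
    unfolding forcing_process_iff
  proof (intro conjI allI impI sub)
    fix t assume t: "t < length (?s # ?s' # ss)"
    consider "t = 0" | "t = 1" | t' where "t = Suc (Suc t')" "t' < length ss"
      using t by (cases t; cases "t - 1") auto
    then show "case (?s # ?s' # ss) ! t of
        Force v W \<Rightarrow> valid_force (blue_at G r X (?s # ?s' # ss) t) v W
      | Backforce u \<Rightarrow>
          0 < t \<and> (\<exists>i W. (?s # ?s' # ss) ! (t - 1) = Force (u, i) W) \<and>
          \<not> cluster r u \<subseteq> blue_at G r X (?s # ?s' # ss) t"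
    proof cases
      case 1
      then show ?thesis using f by simp
    next
      case 2
      then show ?thesis using u by auto
    next
      case (3 t')
      then show ?thesis using ss(1)
        unfolding complete_forcing_process_def forcing_process_iff
        by (auto split: forcing_step.splits)
    qed
  qed
  moreover have "one_cluster_forced_each_step G r X (?s # ?s' # ss)"
    unfolding one_cluster_forced_iff
  proof (intro allI impI)
    fix t assume t: "t < length (?s # ?s' # ss)"
    consider "t = 0" | "t = 1" | t' where "t = Suc (Suc t')" "t' < length ss"
      using t by (cases t; cases "t - 1") auto
    then show "one_forced (blue_at G r X (?s # ?s' # ss) t) (blue_at G r X (?s # ?s' # ss) (Suc t))"
      using one one' ss(2) unfolding one_cluster_forced_iff by cases (auto simp: blue_at_0)
  qed
  ultimately show ?thesis
    using ss(1) unfolding good_def complete_forcing_process_def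
    by (intro exI[of _ "?s # ?s' # ss"]) simp
qed

text \<open>Each white vertex of \<open>Z\<close> is a component of its own, so any vertex of a
  neighboring cluster forces it alone; \<open>Z\<close> is colored one vertex at a time. This is the
  device that whitens clusters at no cost.\<close>

lemma good_isolated:
  assumes "finite Z"
    and "\<And>v k. (v, k) \<in> Z \<Longrightarrow> k < r \<and> (\<exists>u. (u, v) \<in> parcs G) \<and> (\<forall>u. (u, v) \<in> parcs G \<longrightarrow> cluster r u \<subseteq> X)"
    and "good (X \<union> Z)"
  shows "good X"
  using assms
proof (induct Z arbitrary: X rule: finite_induct)
  case (insert z Z)
  obtain v k where z: "z = (v, k)" by force
  have good: "good (X \<union> {z})"
  proof (rule insert(3))
    fix v' k' assume "(v', k') \<in> Z"
    then show "k' < r \<and> (\<exists>u. (u, v') \<in> parcs G) \<and> (\<forall>u. (u, v') \<in> parcs G \<longrightarrow> cluster r u \<subseteq> X \<union> {z})"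
      using insert(4)[of v' k'] by blast
  next
    show "good (X \<union> {z} \<union> Z)" using insert(5) by simp
  qed
  show ?case
  proof (cases "z \<in> X")
    case True
    then show ?thesis using good by (simp add: insert_absorb)
  next
    case False
    obtain u where u: "(u, v) \<in> parcs G" using insert(4) z by blast
    have nb: "cluster r u \<subseteq> X" if "(u, v) \<in> parcs G" for u using insert(4)[of v k] z that by blast
    have kr: "k < r" using insert(4)[of v k] z by blast
    have "v \<notin> active X"
      using nb[OF edge_sym] by (auto simp: active_def unfilled_def)
    moreover obtain W where W: "W \<in> white_components (blowup r G) X" "z \<in> W"
      using component_exists[of z X] False z edge_verts(2)[OF u] kr by auto
    ultimately have Wz: "W = {z}" using component_inactive z by blast
    have eq: "nbrs (u, 0) \<inter> W = {z}" using u kr Wz z r2 by auto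
    have "(u, 0) \<in> X" using nb[OF u] r2 by auto
    then have "valid_force X (u, 0) W" using W eq r2 by (simp add: valid_force_def)
    then show ?thesis
      by (rule good_force[where w = v]) (use eq good z kr u edge_verts in auto)
  qed
qed simp

section \<open>Exchanging blue vertices backwards along a process\<close>

text \<open>Vertices of one cluster are interchangeable, so an initial segment of length
  \<open>b v\<close> can stand for any choice of blue vertices. The values 0, 1 and \<open>r\<close>
  encode None, One and All; outside \<open>A\<close> the value of \<open>b\<close> has no
  effect.\<close>

definition config :: "('a \<Rightarrow> nat) \<Rightarrow> 'a set \<Rightarrow> ('a \<times> nat) set" where
  "config b A = {(v, i). v \<in> pverts G \<and> i < r \<and> (v \<in> A \<longrightarrow> i < b v)}"

lemma in_config [simp]: "(v, i) \<in> config b A \<longleftrightarrow> v \<in> pverts G \<and> i < r \<and> (v \<in> A \<longrightarrow> i < b v)"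
  by (simp add: config_def)

lemma unfilled_config: "unfilled (config b A) = {v \<in> pverts G. v \<in> A \<and> b v < r}"
  by (auto simp: unfilled_iff)

text \<open>
  Blue vertices of inactive clusters are not counted: those clusters can be made entirely white.
\<close>
definition aon_bound :: "('a \<times> nat) set \<Rightarrow> bool" where
  "aon_bound X \<longleftrightarrow> (\<exists>b. (\<forall>v. b v \<in> {0, 1, r}) \<and>
    (\<Sum>v\<in>active X. b v) \<le> (\<Sum>v\<in>active X. card (cluster r v \<inter> X)) \<and> good (config b (active X)))"

lemma aon_bound_verts: "aon_bound verts_r"
proof -
  have u: "active verts_r = {}" by (auto simp: active_def unfilled_iff)
  have "config (\<lambda>_. 0) {} = verts_r" by auto
  then show ?thesis unfolding aon_bound_def u using good_verts by (intro exI[of _ "\<lambda>_. 0"]) simp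
qed

text \<open>An unfilled neighbor that makes a cluster active is itself active. Coloring vertices of
  an inactive cluster therefore changes neither the active clusters nor their blue counts, and
  \<open>aon_bound\<close> depends on nothing else.\<close>

lemma aon_bound_inactive:
  assumes "Z \<subseteq> cluster r w" "w \<notin> active X" "aon_bound (X \<union> Z)"
  shows "aon_bound X"
proof -
  have act: "active (X \<union> Z) = active X"
  proof
    show "active (X \<union> Z) \<subseteq> active X" by (rule active_mono) blast
    show "active X \<subseteq> active (X \<union> Z)"
    proof
      fix v assume v: "v \<in> active X"
      then obtain v' where v': "v' \<in> unfilled X" "(v, v') \<in> parcs G" by (auto simp: active_def)
      then have "v' \<in> active X" 
        using v activeI[of v' X v] edge_sym[of v v'] by (simp add: active_def)
      then have "v \<noteq> w" "v' \<noteq> w" using v assms by auto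
      then have "v \<in> unfilled (X \<union> Z)" "v' \<in> unfilled (X \<union> Z)"
        using v v' assms(1) by (auto simp: active_def unfilled_iff)
      then show "v \<in> active (X \<union> Z)" using v' by (auto intro: activeI)
    qed
  qed
  have "cluster r v \<inter> (X \<union> Z) = cluster r v \<inter> X" if "v \<in> active X" for v
    using that assms by auto
  then show ?thesis using assms(3) unfolding aon_bound_def act by simp
qed

text \<open>The active clusters of \<open>X\<close> split into those that stay active, the forced
  ones \<open>S\<close>, the forcing cluster \<open>U\<close> if it is unfilled, and the clusters
  \<open>J\<close> that merely lose their last unfilled neighbor. Blue vertices are compared block
  by block.\<close>

lemma aon_bound_force:
  assumes f: "valid_force X (u, i) W"
    and w: "(w, j) \<in> nbrs (u, i) \<inter> W" "w \<in> active X"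
    and bound: "aon_bound (X \<union> (nbrs (u, i) \<inter> W))"
  shows "aon_bound X"
proof -
  let ?F = "nbrs (u, i) \<inter> W"
  let ?X' = "X \<union> ?F"
  define S where "S = {v \<in> unfilled X. (u, v) \<in> parcs G \<and> (w, v) \<in> rtrancl_on (unfilled X) (parcs G)}"
  define U where "U = {u} \<inter> unfilled X"
  define J where "J = active X - S - U - active ?X'"
  have W: "W \<in> white_components (blowup r G) X" using f by (simp add: valid_force_def)
  have uw: "(u, w) \<in> parcs G" and ir: "i < r" using w(1) by auto
  have wu: "(w, u) \<in> parcs G" using uw by (rule edge_sym)
  have uV: "u \<in> pverts G" using uw by (rule edge_verts)
  have wX: "w \<in> unfilled X" using w(2) by (simp add: active_def)
  have F: "(v, k) \<in> ?F \<longleftrightarrow> v \<in> S \<and> k < r \<and> (v, k) \<notin> X" for v k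
    using component_active[OF W _ w(2), of j v k] w(1) ir by (auto simp: S_def unfilled_iff)
  have S_active: "v \<in> active X" if vS: "v \<in> S" for v
  proof (rule ccontr)
    assume v: "v \<notin> active X"
    obtain k where "k < r" "(v, k) \<notin> X" using vS by (auto simp: S_def unfilled_iff)
    then have "(v, k) \<in> ?F" using F vS by blast
    then have "W = {(v, k)}" using component_inactive[OF W _ v] by blast
    then show False using w v by auto
  qed
  have wS: "w \<in> S" using wX uw by (auto simp: S_def)
  have uS: "u \<notin> S" by (simp add: S_def no_loop)
  have S_filled: "v \<notin> unfilled ?X'" if "v \<in> S" for v using F that by (auto simp: unfilled_iff)
  have U_active: "v \<in> active X" if "v \<in> U" for v
    using that activeI[of u X w] wX uw by (auto simp: U_def)
  have U_inactive: "v \<notin> active ?X'" if "v \<in> U" for v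
    using that force_inactivates[OF f] by (auto simp: U_def)
  have active_X': "v \<in> active X \<and> v \<notin> S \<and> v \<notin> U" if "v \<in> active ?X'" for v
    using that force_active(1)[OF f that] S_filled U_inactive by (auto simp: active_def)
  have unfilled_X': "v \<in> unfilled ?X'" if "v \<in> unfilled X" "v \<notin> S" for v
    using that F by (auto simp: unfilled_iff)
  have split: "active X = active ?X' \<union> (J \<union> (S \<union> U))"
    using active_X' S_active U_active by (auto simp: J_def)
  have fin: "finite J" "finite S" "finite U"
    using finite_active[of X] unfolding split by auto
  have disj: "active ?X' \<inter> (J \<union> (S \<union> U)) = {}" "J \<inter> (S \<union> U) = {}" "S \<inter> U = {}"
    using active_X' uS by (auto simp: J_def U_def)
  have sum_split: "(\<Sum>v\<in>active X. h v) =
      (\<Sum>v\<in>active ?X'. h v) + ((\<Sum>v\<in>J. h v) + ((\<Sum>v\<in>S. h v) + (\<Sum>v\<in>U. h v)))" for h :: "'a \<Rightarrow> nat"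
    unfolding split using fin disj by (simp add: sum.union_disjoint)
  obtain b' where b': "\<forall>v. b' v \<in> {0, 1, r}"
    "(\<Sum>v\<in>active ?X'. b' v) \<le> (\<Sum>v\<in>active ?X'. card (cluster r v \<inter> ?X'))"
    "good (config b' (active ?X'))"
    using bound unfolding aon_bound_def by blast
  define b where "b = (\<lambda>v. if v \<in> active ?X' then b' v else if v = w then 0
      else if v \<in> S then r else if v \<in> U then 1 else 0)"
  have b_w: "b w = 0" using active_X' wS by (auto simp: b_def)
  have b_S: "b v = r" if "v \<in> S" "v \<noteq> w" for v using that active_X' by (auto simp: b_def)
  have b_U: "b v = 1" if "v \<in> U" for v
    using that active_X' wS uS by (auto simp: b_def U_def)
  have b_J: "b v = 0" if "v \<in> J" for v using that by (auto simp: b_def J_def)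
  have b_values: "\<forall>v. b v \<in> {0, 1, r}" using b'(1) by (simp add: b_def)

  \<comment> \<open>Both sides bound the size \<open>card S * r\<close> of the clusters in
    \<open>S\<close>: on the left it is the new cost plus the cluster of \<open>w\<close>, on the
    right the white vertices, at most \<open>r\<close> of them, plus the blue ones. Keeping
    \<open>r\<close> on both sides avoids truncated subtraction.\<close>
  have "(\<Sum>v\<in>S. b v) + r \<le> r + (\<Sum>v\<in>S. card (cluster r v \<inter> X))"
  proof -
    have "(\<Sum>v\<in>S. b v) = (\<Sum>v\<in>S - {w}. r)"
      using sum.remove[OF fin(2) wS, of b] b_w b_S by simp
    then have "(\<Sum>v\<in>S. b v) + r = card S * r"
      using card_Suc_Diff1[OF fin(2) wS] by (metis add.commute mult_Suc sum_constant of_nat_id)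
    also have "\<dots> = (\<Sum>v\<in>S. card (cluster r v - X) + card (cluster r v \<inter> X))"
    proof -
      have "card (cluster r v - X) + card (cluster r v \<inter> X) = r" for v
        using card_Int_Diff[of "cluster r v" X] by simp
      then show ?thesis by simp
    qed
    also have "\<dots> = (\<Sum>v\<in>S. card (cluster r v - X)) + (\<Sum>v\<in>S. card (cluster r v \<inter> X))"
      by (rule sum.distrib)
    also have "(\<Sum>v\<in>S. card (cluster r v - X)) = card (\<Union>v\<in>S. cluster r v - X)"
      using fin by (subst card_UN_disjoint) auto
    also have "(\<Union>v\<in>S. cluster r v - X) = ?F"
    proof (rule set_eqI)
      fix p
      show "p \<in> (\<Union>v\<in>S. cluster r v - X) \<longleftrightarrow> p \<in> ?F"
        by (cases p) (simp only: F, auto)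
    qed
    finally show ?thesis using f by (simp add: valid_force_def)
  qed
  \<comment> \<open>The forcing vertex \<open>(u, i)\<close> is blue and pays for the single blue
    vertex given to \<open>u\<close>.\<close>
  moreover have "(\<Sum>v\<in>U. b v) \<le> (\<Sum>v\<in>U. card (cluster r v \<inter> X))"
  proof (rule sum_mono)
    fix v assume v: "v \<in> U"
    then have "(v, i) \<in> cluster r v \<inter> X" using f ir by (simp add: U_def valid_force_def)
    then have "cluster r v \<inter> X \<noteq> {}" by (rule ex_in_conv[THEN iffD1, OF exI])
    then have "0 < card (cluster r v \<inter> X)" by (simp add: card_gt_0_iff)
    then show "b v \<le> card (cluster r v \<inter> X)" using b_U[OF v] by simp
  qed
  moreover have "(\<Sum>v\<in>J. b v) = 0" using b_J by simp
  moreover have "(\<Sum>v\<in>active ?X'. b v) \<le> (\<Sum>v\<in>active ?X'. card (cluster r v \<inter> X))"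
  proof -
    have "(\<Sum>v\<in>active ?X'. b v) = (\<Sum>v\<in>active ?X'. b' v)" by (simp add: b_def)
    also have "(\<Sum>v\<in>active ?X'. card (cluster r v \<inter> ?X')) = (\<Sum>v\<in>active ?X'. card (cluster r v \<inter> X))"
      using force_active(2)[OF f] by (intro sum.cong refl) simp
    ultimately show ?thesis using b'(2) by simp
  qed
  ultimately have b_sum: "(\<Sum>v\<in>active X. b v) \<le> (\<Sum>v\<in>active X. card (cluster r v \<inter> X))"
    unfolding sum_split by linarith

  let ?Y = "config b (active X)"
  \<comment> \<open>This is the coloring after \<open>w\<close> has been forced and \<open>u\<close>
    completed; coloring \<open>J\<close> then leads to the set supplied by
    \<open>bound\<close>.\<close>
  let ?Y2 = "?Y \<union> cluster r w \<union> U \<times> {..<r}"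
  have filled_Y: "cluster r v \<subseteq> ?Y" if "v \<in> pverts G" "v \<notin> active X \<or> b v = r" for v
  proof
    fix p assume "p \<in> cluster r v"
    then show "p \<in> ?Y" using that by (cases "v \<in> active X"; cases p) simp_all
  qed
  have "?Y2 \<union> J \<times> {..<r} = config b' (active ?X')"
  proof (rule set_eqI)
    fix p :: "'a \<times> nat"
    obtain v k where p: "p = (v, k)" by force
    show "p \<in> ?Y2 \<union> J \<times> {..<r} \<longleftrightarrow> p \<in> config b' (active ?X')"
    proof (cases "v \<in> active ?X'")
      case True
      then have "v \<in> active X" "v \<noteq> w" "v \<notin> U" "v \<notin> J" "b v = b' v"
        using active_X' wS by (auto simp: J_def b_def)
      then show ?thesis using True p by simp
    next
      case False
      have wV: "w \<in> pverts G" using uw by (rule edge_verts)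
      have UV: "v \<in> pverts G" if "v \<in> U" using that uV by (simp add: U_def)
      have JV: "v \<in> pverts G" if "v \<in> J" using that active_verts[of v X] by (simp add: J_def)
      consider "v \<notin> active X" | "v \<in> active X" "b v = r" | "v = w" | "v \<in> U" | "v \<in> J"
        using b_S False unfolding J_def by blast
      then show ?thesis
      proof cases
        case 1
        then have "v \<noteq> w" "v \<notin> U" "v \<notin> J" using w(2) U_active by (auto simp: J_def)
        then show ?thesis using 1 False p by simp
      next
        case 2
        then show ?thesis using False p active_verts[of v X] by (simp, blast)
      next
        case 3
        then show ?thesis using False p wV by auto
      next
        case 4
        then show ?thesis using False p UV by auto
      next
        case 5
        then show ?thesis using False p JV by auto
      qed
    qed
  qed
  then have good_Y3: "good (?Y2 \<union> J \<times> {..<r})" using b'(3) by simp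
  have good_Y2: "good ?Y2"
  proof (rule good_isolated[OF _ _ good_Y3])
    show "finite (J \<times> {..<r})" using fin by simp
  next
    fix v k assume "(v, k) \<in> J \<times> {..<r}"
    then have v: "v \<in> J" "k < r" by auto
    then have vX: "v \<in> active X" "v \<in> unfilled X" "v \<notin> S" "v \<notin> active ?X'"
      by (auto simp: J_def active_def)
    \<comment> \<open>As \<open>v\<close> stays unfilled but turns inactive, each neighbor was
      either filled by the force, hence in \<open>S\<close>, or blue before it.\<close>
    have "cluster r v' \<subseteq> ?Y2" if e: "(v', v) \<in> parcs G" for v'
    proof -
      have v': "v' \<in> pverts G" using e by (rule edge_verts)
      have "v' \<notin> unfilled X" if "v' \<notin> S"
        using that vX unfilled_X' activeI[of v ?X' v'] edge_sym[OF e] by blast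
      then consider "v' = w" | "v' \<in> S" "v' \<noteq> w" | "v' \<notin> active X" by (auto simp: active_def)
      then show ?thesis
        using filled_Y[OF v'] b_S by cases blast+
    qed
    moreover have "\<exists>v'. (v', v) \<in> parcs G" using vX(1) edge_sym unfolding active_def by blast
    ultimately show "k < r \<and> (\<exists>u. (u, v) \<in> parcs G) \<and> (\<forall>u. (u, v) \<in> parcs G \<longrightarrow> cluster r u \<subseteq> ?Y2)"
      using v(2) by blast
  qed
  have unfilled_Y: "v \<in> unfilled ?Y \<longleftrightarrow> v \<in> active X \<and> b v < r" for v
    unfolding unfilled_config using active_verts by auto
  have wY: "w \<in> unfilled ?Y" using unfilled_Y w(2) b_w r2 by simp
  \<comment> \<open>The exchange may itself deactivate \<open>w\<close>. Its white vertices are then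
    separate components that no single force can take together, so this case is settled by
    \<open>good_isolated\<close>.\<close>
  have "good ?Y"
  proof (cases "w \<in> active ?Y")
    case True
    have w0: "(w, 0) \<in> verts_r - ?Y" using w(2) b_w r2 edge_verts(2)[OF uw] by simp
    obtain W' where W': "W' \<in> white_components (blowup r G) ?Y" "(w, 0) \<in> W'"
      using component_exists[OF w0] .
    \<comment> \<open>Unfilled clusters of \<open>?Y\<close> are unfilled in \<open>X\<close>, so
      whatever \<open>u\<close> would force in this component lies over \<open>S\<close>; there
      every cluster except that of \<open>w\<close> is now entirely blue.\<close>
    have N: "nbrs (u, 0) \<inter> W' = cluster r w"
    proof (intro equalityI subsetI)
      have N_sub: "v = w \<and> k < r" if "(v, k) \<in> nbrs (u, 0) \<inter> W'" for v k
      proof -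
        have vk: "(v, k) \<in> verts_r - ?Y" "(w, v) \<in> rtrancl_on (unfilled ?Y) (parcs G)"
          using that component_active[OF W' True, of v k] by auto
        have "(w, v) \<in> rtrancl_on (unfilled X) (parcs G)"
          by (rule rtrancl_on_mono[OF subset_refl _ vk(2)]) (auto simp: unfilled_Y active_unfilled)
        moreover have vY: "v \<in> unfilled ?Y" using vk(1) by (auto simp: unfilled_iff)
        ultimately have "v \<in> S" using that by (auto simp: S_def unfilled_Y active_unfilled)
        then show ?thesis using b_S vY unfilled_Y vk(1) by auto
      qed
      show "p \<in> cluster r w" if "p \<in> nbrs (u, 0) \<inter> W'" for p
        using N_sub[of "fst p" "snd p"] that by (cases p) simp
      show "p \<in> nbrs (u, 0) \<inter> W'" if "p \<in> cluster r w" for p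
        using that component_active[OF W' True, of w "snd p"] wY w(2) b_w uw r2 edge_verts(2)[OF uw]
        by (cases p) simp
    qed
    \<comment> \<open>The original forcing vertex \<open>(u, i)\<close> may be white in
      \<open>?Y\<close>; the vertex of index 0 is blue in either case and has the same
      neighbors.\<close>
    have "(u, 0) \<in> ?Y"
      using uV r2 b_U[of u] by (auto simp: U_def active_def)
    then have f': "valid_force ?Y (u, 0) W'"
      using W'(1) N r2 by (auto simp: valid_force_def lessThan_empty_iff cluster_def)
    have wV: "w \<in> pverts G" using edge_verts(2)[OF uw] .
    show ?thesis
    proof (cases "u \<in> U")
      case True
      then have "U = {u}" by (auto simp: U_def)
      then have U: "U \<times> {..<r} = cluster r u" by (simp add: cluster_def)
      \<comment> \<open>Backforcing is allowed only for a cluster that still has a white vertex;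
        since \<open>b u = 1\<close> and \<open>r\<close> is at least 2, index 1 provides
        one.\<close>
      have "(u, 1) \<notin> ?Y \<union> cluster r w"
        using U_active[OF True] b_U[OF True] uS wS by auto
      moreover have "(u, 1) \<in> cluster r u" using r2 by simp
      ultimately have "\<not> cluster r u \<subseteq> ?Y \<union> (nbrs (u, 0) \<inter> W')" unfolding N by blast
      then show ?thesis
        using good_force_backforce[OF f' wV _ uV] N good_Y2 U by simp
    next
      case False
      then have "U = {}" by (auto simp: U_def)
      then show ?thesis using good_force[OF f' wV] N good_Y2 by simp
    qed
  next
    case False
    have "U = {}"
    proof (rule ccontr)
      assume "U \<noteq> {}"
      then have "u \<in> U" by (auto simp: U_def)
      then have "u \<in> unfilled ?Y" using unfilled_Y U_active b_U r2 by simp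
      then show False using False activeI[OF wY _ wu] by blast
    qed
    then have "good (?Y \<union> cluster r w)" using good_Y2 by simp
    then show ?thesis
    proof (rule good_isolated[rotated 2])
      fix v k assume v: "(v, k) \<in> cluster r w"
      have "cluster r v' \<subseteq> ?Y" if e: "(v', w) \<in> parcs G" for v'
        using False activeI[OF wY _ edge_sym[OF e]] edge_verts(1)[OF e] by (auto simp: unfilled_def)
      then show "k < r \<and> (\<exists>u. (u, v) \<in> parcs G) \<and> (\<forall>u. (u, v) \<in> parcs G \<longrightarrow> cluster r u \<subseteq> ?Y)"
        using v uw by auto
    qed simp
  qed
  then show ?thesis using b_values b_sum unfolding aon_bound_def by blast
qed

text \<open>Only a force on an active cluster calls for an exchange. A backforced cluster is
  inactive, and a force on an inactive cluster takes a single vertex, so both fall under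
  \<open>aon_bound_inactive\<close>.\<close>

lemma process_aon_bound:
  assumes "complete_forcing_process G r B ss"
  shows "aon_bound B"
proof -
  have process: "forcing_process G r B ss" and full: "blue_at G r B ss (length ss) = verts_r"
    using assms by (simp_all add: complete_forcing_process_def)
  have "aon_bound (blue_at G r B ss t)" if "t \<le> length ss" for t
    using that
  proof (induct rule: inc_induct)
    case base
    then show ?case using full aon_bound_verts by simp
  next
    case (step t)
    let ?X = "blue_at G r B ss t"
    have IH: "aon_bound (?X \<union> colored_by G r (ss ! t))"
      using step blue_at_Suc by simp
    from process step(2) show ?case
    proof (cases rule: process_cases)
      case (Force u i W)
      have W: "W \<in> white_components (blowup r G) ?X" using Force by (simp add: valid_force_def)
      obtain w j where w: "(w, j) \<in> nbrs (u, i) \<inter> W" using valid_forceE[OF Force(2)] .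
      show ?thesis
      proof (cases "w \<in> active ?X")
        case True
        then show ?thesis using aon_bound_force[OF Force(2) w] IH Force(1) by simp
      next
        case False
        then have "W = {(w, j)}" using component_inactive[OF W] w by blast
        then have "nbrs (u, i) \<inter> W \<subseteq> cluster r w" using w by auto
        then show ?thesis using aon_bound_inactive[OF _ False] IH Force(1) by simp
      qed
    next
      case (Backforce u)
      then show ?thesis using aon_bound_inactive[OF subset_refl] IH by simp
    qed
  qed
  from this[of 0] show ?thesis by (simp add: blue_at_0)
qed

section \<open>Existence of an AON minimum set\<close>

text \<open>Some step colors the missing vertex, and both kinds of step presuppose a neighbor. This
  is the neighbor that \<open>good_isolated\<close> asks for when an inactive cluster is
  whitened.\<close>

lemma unfilled_has_neighbor:
  assumes "complete_forcing_process G r B ss" "v \<in> unfilled B"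
  shows "\<exists>u. (u, v) \<in> parcs G"
proof -
  have process: "forcing_process G r B ss" and full: "blue_at G r B ss (length ss) = verts_r"
    using assms by (simp_all add: complete_forcing_process_def)
  obtain k where k: "(v, k) \<in> verts_r" "(v, k) \<notin> B" using assms(2) by (auto simp: unfilled_iff)
  then obtain s where "s \<in> set ss" "(v, k) \<in> colored_by G r s"
    using full[symmetric] by (auto simp: blue_at_def)
  then obtain t where t: "t < length ss" "(v, k) \<in> colored_by G r (ss ! t)"
    by (auto simp: in_set_conv_nth)
  from process t(1) show ?thesis
  proof (cases rule: process_cases)
    case (Force u i W)
    then show ?thesis using t(2) by auto
  next
    case (Backforce u)
    then show ?thesis using t(2) by auto
  qed
qed

lemma card_eq_sum_clusters:
  assumes "X \<subseteq> verts_r"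
  shows "card X = (\<Sum>v\<in>pverts G. card (cluster r v \<inter> X))"
proof -
  have "X = (\<Union>v\<in>pverts G. cluster r v \<inter> X)" using assms by auto
  then have "card X = card (\<Union>v\<in>pverts G. cluster r v \<inter> X)" by simp
  also have "\<dots> = (\<Sum>v\<in>pverts G. card (cluster r v \<inter> X))"
    using finite_verts by (subst card_UN_disjoint) auto
  finally show ?thesis .
qed

lemma aon_minimum_exists:
  "\<exists>B ss. aon_minimum_psd_forcing_set G r B \<and> complete_forcing_process G r B ss \<and>
     one_cluster_forced_each_step G r B ss"
proof -
  have "psd_forcing_set G r verts_r" using good_verts by (auto simp: good_def psd_forcing_set_def)
  then obtain B where B: "psd_forcing_set G r B" "\<And>Y. psd_forcing_set G r Y \<Longrightarrow> card B \<le> card Y"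
    using ex_has_least_nat[of "psd_forcing_set G r" _ card] by blast
  then obtain ss where ss: "complete_forcing_process G r B ss" by (auto simp: psd_forcing_set_def)
  have B_verts: "B \<subseteq> verts_r"
    using ss by (simp add: complete_forcing_process_def forcing_process_def)
  obtain b where b: "\<forall>v. b v \<in> {0, 1, r}"
    "(\<Sum>v\<in>active B. b v) \<le> (\<Sum>v\<in>active B. card (cluster r v \<inter> B))" "good (config b (active B))"
    using process_aon_bound[OF ss] unfolding aon_bound_def by blast
  define b' where "b' = (\<lambda>v. if v \<in> active B then b v else 0)"
  let ?I = "unfilled B - active B"
  let ?B' = "config b' (unfilled B)"
  have unfilled_verts: "unfilled B \<subseteq> pverts G" by (auto simp: unfilled_def)
  have "?B' \<union> ?I \<times> {..<r} = config b (active B)"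
  proof (rule set_eqI)
    fix p
    show "p \<in> ?B' \<union> ?I \<times> {..<r} \<longleftrightarrow> p \<in> config b (active B)"
      using active_unfilled unfilled_verts by (cases p) (auto simp: b'_def)
  qed
  then have good': "good (?B' \<union> ?I \<times> {..<r})" using b(3) by simp
  have good: "good ?B'"
  proof (rule good_isolated[OF _ _ good'])
    show "finite (?I \<times> {..<r})"
      using finite_subset[OF unfilled_verts finite_verts] by simp
  next
    fix v k assume "(v, k) \<in> ?I \<times> {..<r}"
    then have v: "v \<in> unfilled B" "v \<notin> active B" "k < r" by auto
    have "cluster r u \<subseteq> ?B'" if e: "(u, v) \<in> parcs G" for u
      using v activeI[OF v(1) _ edge_sym[OF e]] edge_verts(1)[OF e] by auto
    then show "k < r \<and> (\<exists>u. (u, v) \<in> parcs G) \<and> (\<forall>u. (u, v) \<in> parcs G \<longrightarrow> cluster r u \<subseteq> ?B')"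
      using unfilled_has_neighbor[OF ss v(1)] v(3) by blast
  qed
  have card_config: "card (cluster r v \<inter> ?B') = b' v" if v: "v \<in> unfilled B" for v
  proof -
    have "b' v \<le> r" using b(1)[rule_format, of v] r2 by (auto simp: b'_def)
    then have "cluster r v \<inter> ?B' = {v} \<times> {..<b' v}"
      using v unfilled_verts by auto
    then show ?thesis by (simp add: card_cartesian_product)
  qed
  have "card ?B' \<le> card B"
  proof -
    let ?c = "\<lambda>X v. card (cluster r v \<inter> X)"
    have split: "sum h (pverts G) = sum h (pverts G - active B) + sum h (active B)" for h :: "'a \<Rightarrow> nat"
      by (rule sum.subset_diff) (auto simp: finite_verts dest: active_verts)
    have "sum (?c ?B') (active B) = sum b (active B)"
      using active_unfilled card_config by (simp add: b'_def)
    moreover have "sum (?c ?B') (pverts G - active B) \<le> sum (?c B) (pverts G - active B)"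
    proof (rule sum_mono)
      fix v assume v: "v \<in> pverts G - active B"
      show "?c ?B' v \<le> ?c B v"
      proof (cases "v \<in> unfilled B")
        case True
        then show ?thesis using card_config v by (simp add: b'_def)
      next
        case False
        then have "cluster r v \<subseteq> B" using v by (simp add: unfilled_def)
        then show ?thesis by (intro card_mono) auto
      qed
    qed
    ultimately have "sum (?c ?B') (pverts G) \<le> sum (?c B) (pverts G)"
      unfolding split using b(2) by linarith
    then show ?thesis
      using card_eq_sum_clusters[OF B_verts] card_eq_sum_clusters[OF good_subset[OF good]] by simp
  qed
  moreover have psd: "psd_forcing_set G r ?B'" using good by (auto simp: good_def psd_forcing_set_def)
  ultimately have "minimum_psd_forcing_set G r ?B'"
    using B(2) unfolding minimum_psd_forcing_set_def is_arg_min_def by (meson leD le_trans)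
  moreover have "all_cluster ?B' (cluster r v) \<or> one_cluster ?B' (cluster r v) \<or>
      none_cluster ?B' (cluster r v)" if v: "v \<in> pverts G" for v
  proof (cases "v \<in> unfilled B")
    case True
    have "b' v = 0 \<or> b' v = 1 \<or> b' v = r" using b(1) by (simp add: b'_def)
    then consider "b' v = 0" | "b' v = 1" | "b' v = r" by argo
    then show ?thesis
    proof cases
      case 1
      then show ?thesis using True by (auto simp: none_cluster_def)
    next
      case 2
      then show ?thesis using card_config[OF True] by (simp add: one_cluster_def)
    next
      case 3
      have "p \<in> ?B'" if "p \<in> cluster r v" for p
        using that v 3 by (cases p) simp
      then show ?thesis by (auto simp: all_cluster_def)
    qed
  next
    case False
    then show ?thesis using v by (auto simp: all_cluster_def)
  qed
  ultimately have "aon_minimum_psd_forcing_set G r ?B'"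
    using psd by (auto simp: aon_minimum_psd_forcing_set_def aon_psd_forcing_set_def)
  then show ?thesis using good unfolding good_def by blast
qed

section \<open>Arbitrary processes for clusters of size at least 3\<close>

text \<open>
  Throughout the process the active clusters keep their initial number of blue vertices, at most
  one; two of them contain at least \<open>2 (r - 1) > r\<close> white vertices, too many for a single force.
\<close>
lemma aon_one_cluster_forced:
  assumes "3 \<le> r" "aon_psd_forcing_set G r B" "forcing_process G r B ss"
  shows "one_cluster_forced_each_step G r B ss"
  unfolding one_cluster_forced_iff
proof (intro allI impI)
  have inv: "v \<in> active (blue_at G r B ss t) \<Longrightarrow> card (cluster r v \<inter> blue_at G r B ss t) \<le> 1"
    if "t \<le> length ss" for t v
    using that
  proof (induct t)
    case 0
    then have "v \<in> pverts G" "\<not> all_cluster B (cluster r v)"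
      by (auto simp: blue_at_0 active_def unfilled_def all_cluster_def)
    then have "one_cluster B (cluster r v) \<or> none_cluster B (cluster r v)"
      using assms(2) by (auto simp: aon_psd_forcing_set_def)
    then show ?case by (auto simp: blue_at_0 one_cluster_def none_cluster_def)
  next
    case (Suc t)
    let ?X = "blue_at G r B ss t"
    have t: "t < length ss" using Suc by simp
    from assms(3) t show ?case
    proof (cases rule: process_cases)
      case (Force u i W)
      have eq: "blue_at G r B ss (Suc t) = ?X \<union> (nbrs (u, i) \<inter> W)"
        using blue_at_Suc[OF t] Force(1) by simp
      show ?thesis using Suc(1,2) t force_active[OF Force(2)] unfolding eq by simp
    next
      case (Backforce u)
      have eq: "blue_at G r B ss (Suc t) = ?X \<union> cluster r u"
        using blue_at_Suc[OF t] Backforce(1) by simp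
      have v: "v \<in> active ?X" "v \<noteq> u"
        using Suc(2) active_mono[of ?X "?X \<union> cluster r u"] unfolding eq
        by (auto simp: active_def unfilled_def)
      then have "cluster r v \<inter> (?X \<union> cluster r u) = cluster r v \<inter> ?X" by auto
      then show ?thesis using Suc(1) t v unfolding eq by simp
    qed
  qed
  fix t assume t: "t < length ss"
  let ?X = "blue_at G r B ss t"
  from assms(3) t show "one_forced ?X (blue_at G r B ss (Suc t))"
  proof (cases rule: process_cases)
    case (Force u i W)
    let ?F = "nbrs (u, i) \<inter> W"
    have W: "W \<in> white_components (blowup r G) ?X" using Force by (simp add: valid_force_def)
    obtain w j where w: "(w, j) \<in> ?F" "(u, w) \<in> parcs G" using valid_forceE[OF Force(2)] .
    have large: "cluster r v - ?X \<subseteq> ?F" "r - 1 \<le> card (cluster r v - ?X)"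
      if "(v, k) \<in> ?F" "v \<in> active ?X" for v k
    proof -
      show "cluster r v - ?X \<subseteq> ?F" using force_fills_active[OF Force(2) that] by blast
      show "r - 1 \<le> card (cluster r v - ?X)"
        using inv[of t v] t that(2) card_Int_Diff[of "cluster r v" ?X] by simp
    qed
    have fin: "finite ?F"
      using finite_subset[OF valid_force_white[OF Force(2)]] finite_verts_r by simp
    have sub: "?F \<subseteq> cluster r w"
    proof (rule ccontr)
      assume "\<not> ?F \<subseteq> cluster r w"
      then obtain p where p: "p \<in> ?F" "p \<notin> cluster r w" by blast
      then obtain a k where a: "(a, k) \<in> ?F" "a \<noteq> w" by (cases p) auto
      \<comment> \<open>The component \<open>W\<close> meets two clusters, so it is not a singleton,
        which excludes inactive clusters.\<close>
      have act: "w \<in> active ?X" "a \<in> active ?X"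
        using component_inactive[OF W] w(1) a by blast+
      have "2 * (r - 1) \<le> card (cluster r w - ?X) + card (cluster r a - ?X)"
        using large(2)[OF w(1) act(1)] large(2)[OF a(1) act(2)] by simp
      also have "\<dots> = card ((cluster r w - ?X) \<union> (cluster r a - ?X))"
        using a(2) by (subst card_Un_disjoint) auto
      also have "\<dots> \<le> card ?F"
        using large(1)[OF w(1) act(1)] large(1)[OF a(1) act(2)] fin by (intro card_mono) auto
      also have "\<dots> \<le> r" using Force(2) by (simp add: valid_force_def)
      finally show False using assms(1) by simp
    qed
    have "(w, j) \<notin> ?X" using w(1) valid_force_white[OF Force(2)] by blast
    moreover have "blue_at G r B ss (Suc t) = ?X \<union> ?F" using blue_at_Suc[OF t] Force(1) by simp
    ultimately have "blue_at G r B ss (Suc t) - ?X \<noteq> {}" "blue_at G r B ss (Suc t) - ?X \<subseteq> cluster r w"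
      using w(1) sub by blast+
    then show ?thesis using one_forcedI edge_verts(2)[OF w(2)] by blast
  next
    case (Backforce u)
    then have "blue_at G r B ss (Suc t) - ?X \<noteq> {}" "blue_at G r B ss (Suc t) - ?X \<subseteq> cluster r u"
        "u \<in> pverts G"
      using blue_at_Suc[OF t] by (auto simp: unfilled_def)
    then show ?thesis using one_forcedI by blast
  qed
qed

end

theorem theorem2p6:
  fixes G :: "'a pair_pre_digraph"
  assumes "pair_graph G"
  shows "(\<forall>r\<ge>2. \<exists>B. aon_minimum_psd_forcing_set G r B) \<and>
    (\<forall>r\<ge>3. \<forall>B ss. aon_minimum_psd_forcing_set G r B \<longrightarrow> forcing_process G r B ss \<longrightarrow>
        one_cluster_forced_each_step G r B ss) \<and>
    (\<exists>B ss. aon_minimum_psd_forcing_set G 2 B \<and> complete_forcing_process G 2 B ss \<and>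
        one_cluster_forced_each_step G 2 B ss)"
proof (intro conjI allI impI)
  fix r :: nat assume "2 \<le> r"
  with assms interpret psd_game G r by (rule psd_game.intro)
  show "\<exists>B. aon_minimum_psd_forcing_set G r B" using aon_minimum_exists by blast
next
  fix r :: nat and B ss
  assume r: "3 \<le> r" and B: "aon_minimum_psd_forcing_set G r B" "forcing_process G r B ss"
  interpret psd_game G r using assms r by (simp add: psd_game_def)
  show "one_cluster_forced_each_step G r B ss"
    using aon_one_cluster_forced r B by (simp add: aon_minimum_psd_forcing_set_def)
next
  interpret psd_game G 2 using assms by (simp add: psd_game_def)
  show "\<exists>B ss. aon_minimum_psd_forcing_set G 2 B \<and> complete_forcing_process G 2 B ss \<and>
      one_cluster_forced_each_step G 2 B ss"
    by (rule aon_minimum_exists)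
qed

end
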